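(* The difference $\sigma_v-\frac1{\sigma_f}$ can be arbitrarily large: for every $K>0$ there exists a nonnegative random variable $v$ satisfying (A2), (A4) and (A5) below such that $\sigma_v-\frac{1}{\sigma_f}>K$.
   Context: Conditions on a nonnegative random variable $v$: (A2) $E[v]=1$ and $\sigma_v^2:=\mathrm{Var}[v]<\infty$. (A4) $v$ has a probability density function $f\in\mathcal{C}^3$ with support $(0,\infty)$ (i.e. $f$ is positive and three times continuously differentiable on $(0,\infty)$ and zero elsewhere). $F$ denotes the cumulative distribution function of $v$. (A5) (i) The random variable $\frac{f'(v)}{f(v)}v$ has a finite standard deviation, denoted $\sigma_f$. (ii) There are a monotone nondecreasing function $M$ and $\epsilon_M>0$ such that $\left|\left(\frac{f'}{f}\right)''(x)\,x^3\right|\le M(x)$ for all $x\in(0,\infty)$ and $E[M((1+\epsilon_M)v)]<\infty$. (iii) There are a monotone nondecreasing function $N$ and $\epsilon_N>0$ such that $\left|\frac{xf(x)}{1-F(x)}\right|\le N(x)$ for all $x\in(0,\infty)$ and $E[N((1+\epsilon_N)v)^2]<\infty$. *)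

theory Defs
  imports "HOL-Probability.Probability"
begin

text \<open>
  Being k times continuously differentiable, for an \<^emph>\<open>open\<close> set S: only then does the
  total function deriv, which looks at a full neighbourhood, give the right iterated derivatives.
\<close>
definition C_k_on :: "nat \<Rightarrow> (real \<Rightarrow> real) \<Rightarrow> real set \<Rightarrow> bool" where
  "C_k_on k f S \<longleftrightarrow>
     (\<forall>j<k. \<forall>x\<in>S. (deriv ^^ j) f differentiable (at x)) \<and> continuous_on S ((deriv ^^ k) f)"

definition std_dev :: "'a measure \<Rightarrow> ('a \<Rightarrow> real) \<Rightarrow> real" where
  "std_dev P X = sqrt (prob_space.variance P X)"

text \<open>
  Bochner integrals of non-integrable functions are 0, so finiteness of a mean or variance
  always has to be stated as integrability.
\<close>
definition finite_std_dev :: "'a measure \<Rightarrow> ('a \<Rightarrow> real) \<Rightarrow> bool" where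
  "finite_std_dev P X \<longleftrightarrow> integrable P X \<and> integrable P (\<lambda>\<omega>. (X \<omega>)\<^sup>2)"

definition A2 :: "'a measure \<Rightarrow> ('a \<Rightarrow> real) \<Rightarrow> bool" where
  "A2 P v \<longleftrightarrow> finite_std_dev P v \<and> prob_space.expectation P v = 1"

definition A4 :: "'a measure \<Rightarrow> ('a \<Rightarrow> real) \<Rightarrow> (real \<Rightarrow> real) \<Rightarrow> bool" where
  "A4 P v f \<longleftrightarrow>
     distributed P lborel v (\<lambda>x. ennreal (f x)) \<and>
     (\<forall>x>0. 0 < f x) \<and> (\<forall>x\<le>0. f x = 0) \<and> C_k_on 3 f {0<..}"

definition score :: "('a \<Rightarrow> real) \<Rightarrow> (real \<Rightarrow> real) \<Rightarrow> 'a \<Rightarrow> real" where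
  "score v f \<omega> = deriv f (v \<omega>) / f (v \<omega>) * v \<omega>"

text \<open>
  The dominating functions M and N are only constrained on the open half-line, where v lives almost
  surely. The denominator in (iii) is positive for every density as in A4.
\<close>
definition A5 :: "'a measure \<Rightarrow> ('a \<Rightarrow> real) \<Rightarrow> (real \<Rightarrow> real) \<Rightarrow> bool" where
  "A5 P v f \<longleftrightarrow>
     finite_std_dev P (score v f) \<and>
     (\<exists>M \<epsilon>. mono_on {0<..} M \<and> 0 < \<epsilon> \<and>
        (\<forall>x>0. \<bar>(deriv ^^ 2) (\<lambda>y. deriv f y / f y) x * x ^ 3\<bar> \<le> M x) \<and>
        integrable P (\<lambda>\<omega>. M ((1 + \<epsilon>) * v \<omega>))) \<and>
     (\<exists>N \<epsilon>. mono_on {0<..} N \<and> 0 < \<epsilon> \<and>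
        (\<forall>x>0. \<bar>x * f x / (1 - cdf (distr P borel v) x)\<bar> \<le> N x) \<and>
        integrable P (\<lambda>\<omega>. (N ((1 + \<epsilon>) * v \<omega>))\<^sup>2))"

text \<open>
  No junk value 1/0 can occur here: if the standard deviation were 0, x f'(x)/f(x) would be constant
  on the open half-line, so f would be a multiple of a power of x there and not integrable.
\<close>
definition sigma_f :: "'a measure \<Rightarrow> ('a \<Rightarrow> real) \<Rightarrow> (real \<Rightarrow> real) \<Rightarrow> real" where
  "sigma_f P v f = std_dev P (score v f)"

end

theory Submission
  imports Defs
begin

text \<open>
  The witnesses are Lomax (shifted Pareto) variables with tail \<open>P (v > x) = (1 + x / s) powr - \<alpha>\<close>,
  where \<open>\<alpha> > 2\<close> and the scale \<open>s = \<alpha> - 1\<close> normalises the mean to 1. As \<open>\<alpha>\<close> decreases to 2 the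
  second moment is about to be lost, so \<open>\<sigma>\<^sub>v\<close> blows up. The quantity \<open>x f'(x) / f(x)\<close> does
  not feel this: it decreases from 0 to \<open>- (\<alpha> + 1)\<close> over the half-line, and its variance stays away
  from 0. More precisely, both \<open>v\<close> and the score are affine functions of a power of
  \<open>W = 1 + v / s\<close>, namely \<open>v = s W - s\<close> and \<open>x f'(x) / f(x) = (\<alpha> + 1) / W - (\<alpha> + 1)\<close>.
  Since \<open>E (W powr p) = \<alpha> / (\<alpha> - p)\<close> for every \<open>p < \<alpha>\<close>, this gives
  \<open>\<sigma>\<^sub>v\<^sup>2 = \<alpha> / (\<alpha> - 2)\<close> and \<open>\<sigma>\<^sub>f\<^sup>2 = \<alpha> / (\<alpha> + 2) \<ge> 1 / 2\<close>.
  So \<open>1 / \<sigma>\<^sub>f\<close> is at most \<open>sqrt 2\<close> while \<open>\<sigma>\<^sub>v\<close> is unbounded.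

  The regularity conditions cost nothing, because the dominating functions may be taken constant:
  \<open>(f'/f)''(x) x^3 = - 2 (\<alpha> + 1) (x / (s + x))^3\<close> and the hazard expression
  \<open>x f(x) / (1 - F(x)) = \<alpha> x / (s + x)\<close> are both bounded.
\<close>

section \<open>Iterated derivatives on open sets\<close>

text \<open>
  The total function \<^const>\<open>deriv\<close> only sees the germ of its argument, so on an open set a
  chain of derivatives may be computed from formulas that are valid there and nowhere else.
\<close>
lemma deriv_funpow_eq_on_open:
  fixes g :: "nat \<Rightarrow> real \<Rightarrow> real"
  assumes "open S"
    and g0: "\<And>x. x \<in> S \<Longrightarrow> f x = g 0 x"
    and gSuc: "\<And>j x. x \<in> S \<Longrightarrow> (g j has_real_derivative g (Suc j) x) (at x)"
    and "x \<in> S"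
  shows "(deriv ^^ j) f x = g j x"
    and "((deriv ^^ j) f has_real_derivative g (Suc j) x) (at x)"
proof -
  have step: "(h has_real_derivative g (Suc j) x) (at x)"
    if "\<And>y. y \<in> S \<Longrightarrow> h y = g j y" "x \<in> S" for h j x
    using has_field_derivative_transform_within_open[OF gSuc[OF \<open>x \<in> S\<close>] \<open>open S\<close> \<open>x \<in> S\<close>] that
    by simp
  have eq: "(deriv ^^ j) f x = g j x" if "x \<in> S" for x j
    using that
  proof (induction j arbitrary: x)
    case 0
    then show ?case by (simp add: g0)
  next
    case (Suc j)
    show ?case
      using DERIV_imp_deriv[OF step[OF Suc.IH \<open>x \<in> S\<close>]] by simp
  qed
  show "(deriv ^^ j) f x = g j x" by (rule eq[OF \<open>x \<in> S\<close>])
  show "((deriv ^^ j) f has_real_derivative g (Suc j) x) (at x)"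
    by (rule step[OF eq \<open>x \<in> S\<close>])
qed

lemma C_k_on_derivative_chain:
  fixes g :: "nat \<Rightarrow> real \<Rightarrow> real"
  assumes "open S"
    and "\<And>x. x \<in> S \<Longrightarrow> f x = g 0 x"
    and "\<And>j x. x \<in> S \<Longrightarrow> (g j has_real_derivative g (Suc j) x) (at x)"
  shows "C_k_on k f S"
  unfolding C_k_on_def
  using deriv_funpow_eq_on_open(2)[OF assms]
  by (auto intro!: continuous_at_imp_continuous_on DERIV_isCont simp: real_differentiable_def)

section \<open>Variance of an affine image\<close>

lemma (in prob_space) variance_affine:
  fixes X :: "'a \<Rightarrow> real"
  assumes "integrable M X"
  shows "variance (\<lambda>\<omega>. a * X \<omega> + b) = a\<^sup>2 * variance X"
proof -
  have "variance (\<lambda>\<omega>. a * X \<omega> + b) = expectation (\<lambda>\<omega>. a\<^sup>2 * (X \<omega> - expectation X)\<^sup>2)"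
  proof -
    have "expectation (\<lambda>\<omega>. a * X \<omega> + b) = a * expectation X + b"
      using assms by (simp add: prob_space)
    then have "(a * X \<omega> + b - expectation (\<lambda>\<omega>. a * X \<omega> + b))\<^sup>2 = a\<^sup>2 * (X \<omega> - expectation X)\<^sup>2" for \<omega>
      by (simp add: algebra_simps flip: power_mult_distrib)
    then show ?thesis by simp
  qed
  then show ?thesis by simp
qed

lemma (in prob_space) std_dev_affine:
  fixes X :: "'a \<Rightarrow> real"
  assumes "integrable M X"
  shows "std_dev M (\<lambda>\<omega>. a * X \<omega> + b) = \<bar>a\<bar> * std_dev M X"
  using variance_affine[OF assms] by (simp add: std_dev_def real_sqrt_mult)

lemma (in prob_space) finite_std_dev_affine:
  assumes "finite_std_dev M X"
  shows "finite_std_dev M (\<lambda>\<omega>. a * X \<omega> + b)"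
proof -
  have "(\<lambda>\<omega>. (a * X \<omega> + b)\<^sup>2) = (\<lambda>\<omega>. a\<^sup>2 * (X \<omega>)\<^sup>2 + 2 * a * b * X \<omega> + b\<^sup>2)"
    by (simp add: fun_eq_iff power2_eq_square algebra_simps)
  then show ?thesis
    using assms by (simp add: finite_std_dev_def)
qed

section \<open>The Lomax distribution\<close>

definition lomax_density :: "real \<Rightarrow> real \<Rightarrow> real \<Rightarrow> real" where
  "lomax_density \<alpha> s x = (if 0 < x then \<alpha> / s * (1 + x / s) powr (- \<alpha> - 1) else 0)"

lemma lomax_density_measurable [measurable]: "lomax_density \<alpha> s \<in> borel_measurable borel"
  unfolding lomax_density_def by measurable

lemma DERIV_shifted_powr:
  fixes s x p :: real
  assumes "s \<noteq> 0" "0 < 1 + x / s"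
  shows "((\<lambda>x. (1 + x / s) powr p) has_real_derivative p / s * (1 + x / s) powr (p - 1)) (at x)"
  using assms by (auto intro!: derivative_eq_intros)

text \<open>
  The weight \<open>(1 + x / s) powr p\<close> merely shifts the exponent of the density. So one improper
  integral covers the total mass (\<open>p = 0\<close>, \<open>c = 0\<close>), the tail of the distribution (\<open>p = 0\<close>) and
  all the moments needed (\<open>c = 0\<close>).
\<close>
lemma nn_integral_lomax_density:
  assumes "0 < \<alpha>" "0 < s" "0 \<le> c" "p < \<alpha>"
  shows "(\<integral>\<^sup>+x. ennreal (lomax_density \<alpha> s x) * (ennreal ((1 + x / s) powr p) * indicator {c<..} x) \<partial>lborel)
    = ennreal (\<alpha> / (\<alpha> - p) * (1 + c / s) powr (p - \<alpha>))"
proof -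
  let ?F = "\<lambda>x. - (\<alpha> / (\<alpha> - p)) * (1 + x / s) powr (p - \<alpha>)"
  let ?f = "\<lambda>x. \<alpha> / s * (1 + x / s) powr (p - \<alpha> - 1)"
  have "(\<integral>\<^sup>+x. ennreal (lomax_density \<alpha> s x) * (ennreal ((1 + x / s) powr p) * indicator {c<..} x) \<partial>lborel)
      = (\<integral>\<^sup>+x. ennreal (?f x) * indicator {c..} x \<partial>lborel)"
  proof (rule nn_integral_cong_AE)
    have "AE x in lborel. x \<noteq> c" by (rule AE_lborel_singleton)
    then show "AE x in lborel. ennreal (lomax_density \<alpha> s x) * (ennreal ((1 + x / s) powr p) * indicator {c<..} x)
        = ennreal (?f x) * indicator {c..} x"
    proof eventually_elim
      case (elim x)
      show ?case
      proof (cases "c < x")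
        case True
        have "ennreal (lomax_density \<alpha> s x) * ennreal ((1 + x / s) powr p) = ennreal (?f x)"
          using True assms
          by (simp add: lomax_density_def mult.assoc diff_diff_eq flip: ennreal_mult powr_add)
            (simp add: algebra_simps)
        then show ?thesis using True by simp
      next
        case False
        then show ?thesis using elim by (simp add: indicator_def)
      qed
    qed
  qed
  also have "\<dots> = ennreal (0 - ?F c)"
  proof (rule nn_integral_FTC_atLeast)
    fix x assume "c \<le> x"
    then have pos: "0 < 1 + x / s" using assms by (simp add: add_pos_nonneg)
    show "(?F has_real_derivative ?f x) (at x)"
    proof -
      have "- (\<alpha> / (\<alpha> - p)) * ((p - \<alpha>) / s * (1 + x / s) powr (p - \<alpha> - 1)) = ?f x"
        using assms by (simp add: divide_simps) (simp add: algebra_simps)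
      then show ?thesis
        using DERIV_cmult[OF DERIV_shifted_powr[OF _ pos, of "p - \<alpha>"], of "- (\<alpha> / (\<alpha> - p))"] assms
        by simp
    qed
    show "0 \<le> ?f x" using assms by simp
  next
    have "LIM x at_top. 1 + x / s :> at_top"
      using assms filterlim_tendsto_pos_mult_at_top[OF tendsto_const[of "1 / s"] _ filterlim_ident[of at_top]]
      by (intro filterlim_tendsto_add_at_top[OF tendsto_const]) auto
    then have "((\<lambda>x. (1 + x / s) powr (p - \<alpha>)) \<longlongrightarrow> 0) at_top"
      using assms by (intro tendsto_neg_powr) auto
    from tendsto_mult_right_zero[OF this] show "(?F \<longlongrightarrow> 0) at_top" .
  qed measurable
  finally show ?thesis by simp
qed

text \<open>
  The variable has to be nonnegative everywhere, not just almost surely, so the identity is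
  truncated at 0; this changes it only on a null set.
\<close>
lemma lomax_distributed_max_0:
  assumes "0 < \<alpha>" "0 < s"
  shows "prob_space (density lborel (lomax_density \<alpha> s))"
    and "distributed (density lborel (lomax_density \<alpha> s)) lborel (max 0) (lomax_density \<alpha> s)"
proof -
  let ?P = "density lborel (\<lambda>x. ennreal (lomax_density \<alpha> s x))"
  have "emeasure ?P (space ?P)
      = (\<integral>\<^sup>+x. ennreal (lomax_density \<alpha> s x) * (ennreal ((1 + x / s) powr 0) * indicator {0<..} x) \<partial>lborel)"
  proof -
    have "ennreal (lomax_density \<alpha> s x)
        = ennreal (lomax_density \<alpha> s x) * (ennreal ((1 + x / s) powr 0) * indicator {0<..} x)" for x
      using assms by (auto simp: lomax_density_def indicator_def add_pos_pos divide_pos_pos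
        less_imp_neq[THEN not_sym])
    then show ?thesis by (simp add: emeasure_density cong: nn_integral_cong)
  qed
  also have "\<dots> = 1"
    using assms by (subst nn_integral_lomax_density) auto
  finally show "prob_space ?P" by (rule prob_spaceI)
  have "AE x in ?P. max 0 x = x"
    by (subst AE_density) (auto simp: lomax_density_def)
  then have "distr ?P lborel (max 0) = distr ?P lborel (\<lambda>x. x)"
    by (intro distr_cong_AE) auto
  also have "\<dots> = ?P" by (rule distr_id2) simp
  finally show "distributed ?P lborel (max 0) (lomax_density \<alpha> s)"
    by (simp add: distributed_def)
qed

locale lomax_variable = prob_space M for M :: "'a measure" +
  fixes v :: "'a \<Rightarrow> real" and \<alpha> s :: real
  assumes shape_pos: "0 < \<alpha>" and scale_pos: "0 < s"
    and nonneg: "\<omega> \<in> space M \<Longrightarrow> 0 \<le> v \<omega>"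
    and distributed: "distributed M lborel v (lomax_density \<alpha> s)"
begin

lemma v_measurable [measurable]: "v \<in> borel_measurable M"
  using distributed_measurable[OF distributed] by simp

text \<open>A Pareto variable on \<open>[1, \<infinity>)\<close> with index \<open>\<alpha>\<close>, free of the scale \<open>s\<close>.\<close>
definition W :: "'a \<Rightarrow> real" where "W \<omega> = 1 + v \<omega> / s"

lemma W_measurable [measurable]: "W \<in> borel_measurable M"
  unfolding W_def by measurable

lemma W_ge_1: "\<omega> \<in> space M \<Longrightarrow> 1 \<le> W \<omega>"
  using nonneg scale_pos by (simp add: W_def)

lemma has_bochner_integral_W_powr:
  assumes "p < \<alpha>"
  shows "has_bochner_integral M (\<lambda>\<omega>. W \<omega> powr p) (\<alpha> / (\<alpha> - p))"
proof (rule has_bochner_integral_nn_integral)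
  have "(\<integral>\<^sup>+\<omega>. ennreal (W \<omega> powr p) \<partial>M)
      = (\<integral>\<^sup>+x. ennreal (lomax_density \<alpha> s x) * ennreal ((1 + x / s) powr p) \<partial>lborel)"
    unfolding W_def by (subst distributed_nn_integral[OF distributed]) auto
  also have "\<dots> = (\<integral>\<^sup>+x. ennreal (lomax_density \<alpha> s x) * (ennreal ((1 + x / s) powr p) * indicator {0<..} x) \<partial>lborel)"
    by (intro nn_integral_cong) (auto simp: lomax_density_def indicator_def)
  also have "\<dots> = ennreal (\<alpha> / (\<alpha> - p))"
    using assms shape_pos scale_pos by (subst nn_integral_lomax_density) auto
  finally show "(\<integral>\<^sup>+\<omega>. ennreal (W \<omega> powr p) \<partial>M) = ennreal (\<alpha> / (\<alpha> - p))" .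
qed (use assms shape_pos in auto)

lemma
  assumes "p < \<alpha>"
  shows integrable_W_powr: "integrable M (\<lambda>\<omega>. W \<omega> powr p)"
    and expectation_W_powr: "expectation (\<lambda>\<omega>. W \<omega> powr p) = \<alpha> / (\<alpha> - p)"
  using has_bochner_integral_W_powr[OF assms] by (auto simp: has_bochner_integral_iff)

lemma W_powr_squared: "\<omega> \<in> space M \<Longrightarrow> (W \<omega> powr p)\<^sup>2 = W \<omega> powr (2 * p)"
  using W_ge_1[of \<omega>] by (simp add: power2_eq_square flip: powr_add)

lemma finite_std_dev_W_powr:
  assumes "p < \<alpha>" "2 * p < \<alpha>"
  shows "finite_std_dev M (\<lambda>\<omega>. W \<omega> powr p)"
  using assms integrable_W_powr
  by (auto simp: finite_std_dev_def W_powr_squared cong: Bochner_Integration.integrable_cong)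

text \<open>
  The squared factor is split off because at \<open>p = 1\<close> and \<open>p = - 1\<close> it cancels against the slopes
  \<open>\<alpha> - 1\<close> and \<open>\<alpha> + 1\<close> of the affine maps that lead to \<open>v\<close> (of mean 1) and to the score.
\<close>
lemma variance_W_powr:
  assumes "p < \<alpha>" "2 * p < \<alpha>"
  shows "variance (\<lambda>\<omega>. W \<omega> powr p) = \<alpha> / (\<alpha> - 2 * p) * (p / (\<alpha> - p))\<^sup>2"
proof -
  have "variance (\<lambda>\<omega>. W \<omega> powr p) = \<alpha> / (\<alpha> - 2 * p) - (\<alpha> / (\<alpha> - p))\<^sup>2"
    using assms finite_std_dev_W_powr[OF assms]
    by (subst variance_eq)
      (auto simp: finite_std_dev_def W_powr_squared expectation_W_powr
        cong: Bochner_Integration.integral_cong)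
  also have "\<dots> = \<alpha> / (\<alpha> - 2 * p) * (p / (\<alpha> - p))\<^sup>2"
  proof -
    have "\<alpha> - 2 * p \<noteq> 0" "(\<alpha> - p)\<^sup>2 \<noteq> 0" using assms by auto
    then show ?thesis
      by (simp add: power_divide diff_frac_eq) (simp add: power2_eq_square algebra_simps)
  qed
  finally show ?thesis .
qed

lemma std_dev_W_powr:
  assumes "p < \<alpha>" "2 * p < \<alpha>"
  shows "std_dev M (\<lambda>\<omega>. W \<omega> powr p) = sqrt (\<alpha> / (\<alpha> - 2 * p)) * (\<bar>p\<bar> / (\<alpha> - p))"
  unfolding std_dev_def variance_W_powr[OF assms] real_sqrt_mult real_sqrt_abs
  using assms by (simp add: abs_divide)

lemma survival_function:
  assumes "0 \<le> x"
  shows "1 - cdf (distr M borel v) x = (1 + x / s) powr (- \<alpha>)"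
proof -
  interpret D: prob_space "distr M borel v" by (rule prob_space_distr) measurable
  have "1 - cdf (distr M borel v) x = D.prob {x<..}"
    using D.prob_compl[of "{..x}"] by (simp add: cdf_def Compl_atMost flip: Compl_eq_Diff_UNIV)
  then have "ennreal (1 - cdf (distr M borel v) x) = emeasure M (v -` {x<..} \<inter> space M)"
    by (simp add: emeasure_distr flip: D.emeasure_eq_measure)
  also have "\<dots> = (\<integral>\<^sup>+t. ennreal (lomax_density \<alpha> s t) * indicator {x<..} t \<partial>lborel)"
    by (rule distributed_emeasure[OF distributed]) simp
  also have "\<dots> = (\<integral>\<^sup>+t. ennreal (lomax_density \<alpha> s t) * (ennreal ((1 + t / s) powr 0) * indicator {x<..} t) \<partial>lborel)"
    using assms scale_pos
    by (intro nn_integral_cong) (auto simp: indicator_def add_pos_pos less_imp_neq[THEN not_sym])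
  also have "\<dots> = ennreal ((1 + x / s) powr (- \<alpha>))"
    using assms shape_pos scale_pos by (subst nn_integral_lomax_density) auto
  finally show ?thesis
    using D.prob_le_1 by (simp add: cdf_def)
qed

end

section \<open>Derivatives of the density and of its logarithmic derivative\<close>

context lomax_variable
begin

lemma shifted_pos: "0 < x \<Longrightarrow> 0 < 1 + x / s"
  using scale_pos by (simp add: add_pos_pos)

text \<open>The \<open>j\<close>-th derivative collects a falling factorial of the exponent, one factor \<open>1 / s\<close> per step.\<close>
lemma C_k_on_lomax_density: "C_k_on k (lomax_density \<alpha> s) {0<..}"
proof (rule C_k_on_derivative_chain)
  let ?g = "\<lambda>(j::nat) x. \<alpha> / s * (\<Prod>i<j. (- \<alpha> - 1 - real i) / s) * (1 + x / s) powr (- \<alpha> - 1 - real j)"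
  show "(?g j has_real_derivative ?g (Suc j) x) (at x)" if "x \<in> {0<..}" for j x
  proof -
    have "- \<alpha> - 1 - real j - 1 = - \<alpha> - 1 - real (Suc j)" by simp
    then show ?thesis
      using that scale_pos DERIV_cmult[OF DERIV_shifted_powr[OF _ shifted_pos, of x "- \<alpha> - 1 - real j"],
        of "\<alpha> / s * (\<Prod>i<j. (- \<alpha> - 1 - real i) / s)"]
      by (simp only: prod.lessThan_Suc mult.assoc) simp
  qed
qed (auto simp: lomax_density_def)

lemma log_derivative_lomax_density:
  assumes "0 < x"
  shows "deriv (lomax_density \<alpha> s) x / lomax_density \<alpha> s x = - (\<alpha> + 1) / (s + x)"
proof -
  have "((\<lambda>x. \<alpha> / s * (1 + x / s) powr (- \<alpha> - 1)) has_real_derivative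
      \<alpha> / s * ((- \<alpha> - 1) / s * (1 + x / s) powr (- \<alpha> - 1 - 1))) (at x)"
    by (intro DERIV_cmult DERIV_shifted_powr shifted_pos assms) (use scale_pos in simp)
  then have "(lomax_density \<alpha> s has_real_derivative
      \<alpha> / s * ((- \<alpha> - 1) / s * (1 + x / s) powr (- \<alpha> - 1 - 1))) (at x)"
    by (rule has_field_derivative_transform_within_open[where S = "{0<..}"])
      (use assms in \<open>auto simp: lomax_density_def\<close>)
  moreover have "(1 + x / s) powr (- \<alpha> - 1 - 1) = (1 + x / s) powr (- \<alpha> - 1) / (1 + x / s)"
    using shifted_pos[OF assms] by (subst powr_diff) simp
  ultimately show ?thesis
    using assms shape_pos scale_pos shifted_pos[OF assms]
    by (simp add: DERIV_imp_deriv lomax_density_def divide_simps)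
qed

lemma second_deriv_log_derivative:
  assumes "0 < x"
  shows "(deriv ^^ 2) (\<lambda>y. deriv (lomax_density \<alpha> s) y / lomax_density \<alpha> s y) x
    = - 2 * (\<alpha> + 1) / (s + x) ^ 3"
proof -
  let ?g = "\<lambda>(j::nat) x. - (\<alpha> + 1) * (-1) ^ j * fact j * inverse (s + x) ^ Suc j"
  have "(deriv ^^ 2) (\<lambda>y. deriv (lomax_density \<alpha> s) y / lomax_density \<alpha> s y) x = ?g 2 x"
  proof (rule deriv_funpow_eq_on_open(1)[where S = "{0<..}"])
    show "(?g j has_real_derivative ?g (Suc j) x) (at x)" if "x \<in> {0<..}" for j x
    proof -
      have "s + x \<noteq> 0" using that scale_pos by simp
      then have "((\<lambda>x. inverse (s + x)) has_real_derivative - (inverse (s + x) ^ 2)) (at x)"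
        by (auto intro!: derivative_eq_intros simp: power2_eq_square)
      from DERIV_cmult[OF DERIV_power[OF this, of "Suc j"], of "- (\<alpha> + 1) * (-1) ^ j * fact j"]
      show ?thesis
        by (rule DERIV_cong) (simp add: power2_eq_square algebra_simps)
    qed
  qed (use assms log_derivative_lomax_density in \<open>auto simp: inverse_eq_divide\<close>)
  then show ?thesis by (simp add: numeral_eq_Suc inverse_eq_divide power_divide)
qed

section \<open>The three conditions and the two standard deviations\<close>

text \<open>The value at \<open>v \<omega> = 0\<close>, where the density jumps, is 0 on both sides.\<close>
lemma score_eq:
  assumes "\<omega> \<in> space M"
  shows "score v (lomax_density \<alpha> s) \<omega> = (\<alpha> + 1) * W \<omega> powr (-1) + (- (\<alpha> + 1))"
proof (cases "v \<omega> = 0")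
  case True
  then show ?thesis by (simp add: score_def W_def)
next
  case False
  with nonneg[OF assms] have "0 < v \<omega>" by simp
  then show ?thesis
    unfolding score_def log_derivative_lomax_density[OF \<open>0 < v \<omega>\<close>]
    using W_ge_1[OF assms] scale_pos
    by (simp add: powr_minus W_def divide_simps) (simp add: algebra_simps)
qed

lemma v_eq:
  assumes "\<omega> \<in> space M"
  shows "v \<omega> = s * W \<omega> powr 1 + (- s)"
  using W_ge_1[OF assms] scale_pos by (simp add: W_def algebra_simps)

lemma finite_std_dev_v:
  assumes "2 < \<alpha>"
  shows "finite_std_dev M v"
  using finite_std_dev_affine[OF finite_std_dev_W_powr[of 1], of s "- s"] assms
  by (simp add: finite_std_dev_def v_eq cong: Bochner_Integration.integrable_cong)

lemma std_dev_cong: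
  assumes "\<And>\<omega>. \<omega> \<in> space M \<Longrightarrow> X \<omega> = Y \<omega>"
  shows "std_dev M X = std_dev M Y"
  using assms by (simp add: std_dev_def cong: Bochner_Integration.integral_cong)

lemma expectation_v:
  assumes "1 < \<alpha>"
  shows "expectation v = s / (\<alpha> - 1)"
proof -
  have "expectation v = expectation (\<lambda>\<omega>. s * W \<omega> powr 1 + (- s))"
    by (intro Bochner_Integration.integral_cong refl v_eq)
  also have "\<dots> = s * (\<alpha> / (\<alpha> - 1)) + (- s)"
    using assms integrable_W_powr[of 1] expectation_W_powr[of 1] by (simp add: prob_space)
  also have "\<dots> = s / (\<alpha> - 1)"
    using assms by (simp add: field_simps)
  finally show ?thesis .
qed

lemma std_dev_v:
  assumes "2 < \<alpha>"
  shows "std_dev M v = s / (\<alpha> - 1) * sqrt (\<alpha> / (\<alpha> - 2))"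
  using assms scale_pos std_dev_affine[OF integrable_W_powr[of 1], of s "- s"]
    std_dev_W_powr[of 1]
  by (simp add: std_dev_cong[OF v_eq])

lemma finite_std_dev_score: "finite_std_dev M (score v (lomax_density \<alpha> s))"
  using finite_std_dev_affine[OF finite_std_dev_W_powr[of "-1"], of "\<alpha> + 1" "- (\<alpha> + 1)"] shape_pos
  by (simp add: finite_std_dev_def score_eq cong: Bochner_Integration.integrable_cong)

lemma sigma_f_lomax: "sigma_f M v (lomax_density \<alpha> s) = sqrt (\<alpha> / (\<alpha> + 2))"
  using shape_pos std_dev_affine[OF integrable_W_powr[of "-1"], of "\<alpha> + 1" "- (\<alpha> + 1)"]
    std_dev_W_powr[of "-1"]
  by (simp add: sigma_f_def std_dev_cong[OF score_eq])

lemma A4_lomax: "A4 M v (lomax_density \<alpha> s)"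
  using distributed C_k_on_lomax_density[of 3] shape_pos scale_pos shifted_pos
  by (auto simp: A4_def lomax_density_def less_imp_neq[THEN not_sym])

lemma hazard_lomax:
  assumes "0 < x"
  shows "x * lomax_density \<alpha> s x / (1 - cdf (distr M borel v) x) = \<alpha> * (x / (s + x))"
proof -
  have "(1 + x / s) powr (- \<alpha> - 1) = (1 + x / s) powr (- \<alpha>) / (1 + x / s)"
    using shifted_pos[OF assms] by (subst powr_diff) simp
  then show ?thesis
    using assms shifted_pos[OF assms] scale_pos survival_function[of x]
    by (simp add: lomax_density_def divide_simps)
qed

lemma A5_lomax: "A5 M v (lomax_density \<alpha> s)"
proof -
  let ?f = "lomax_density \<alpha> s"
  have frac: "0 \<le> x / (s + x)" "x / (s + x) \<le> 1" if "0 < x" for x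
    using that scale_pos by auto
  have "\<bar>(deriv ^^ 2) (\<lambda>y. deriv ?f y / ?f y) x * x ^ 3\<bar> \<le> 2 * (\<alpha> + 1)" if "0 < x" for x
  proof -
    have "\<bar>(deriv ^^ 2) (\<lambda>y. deriv ?f y / ?f y) x * x ^ 3\<bar> = 2 * (\<alpha> + 1) * (x / (s + x)) ^ 3"
      using that scale_pos shape_pos
      by (simp add: second_deriv_log_derivative[OF that] abs_mult power_divide)
    also have "\<dots> \<le> 2 * (\<alpha> + 1) * 1"
      using frac[OF that] shape_pos by (intro mult_left_mono power_le_one) auto
    finally show ?thesis by simp
  qed
  then have ii: "\<exists>B \<epsilon>. mono_on {0<..} B \<and> 0 < \<epsilon> \<and>
        (\<forall>x>0. \<bar>(deriv ^^ 2) (\<lambda>y. deriv ?f y / ?f y) x * x ^ 3\<bar> \<le> B x) \<and>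
        integrable M (\<lambda>\<omega>. B ((1 + \<epsilon>) * v \<omega>))"
    by (intro exI[of _ "\<lambda>_. 2 * (\<alpha> + 1)"] exI[of _ 1]) (auto intro: mono_onI)
  have "\<bar>x * ?f x / (1 - cdf (distr M borel v) x)\<bar> \<le> \<alpha>" if "0 < x" for x
    unfolding hazard_lomax[OF that]
    using frac[OF that] shape_pos by (simp only: abs_of_nonneg mult_left_le mult_nonneg_nonneg less_imp_le)
  then have iii: "\<exists>N \<epsilon>. mono_on {0<..} N \<and> 0 < \<epsilon> \<and>
        (\<forall>x>0. \<bar>x * ?f x / (1 - cdf (distr M borel v) x)\<bar> \<le> N x) \<and>
        integrable M (\<lambda>\<omega>. (N ((1 + \<epsilon>) * v \<omega>))\<^sup>2)"
    by (intro exI[of _ "\<lambda>_. \<alpha>"] exI[of _ 1]) (auto intro: mono_onI)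
  show ?thesis
    unfolding A5_def using finite_std_dev_score ii iii by blast
qed

end

section \<open>The gap is unbounded\<close>

theorem theorem5p9:
  fixes K :: real
  assumes "K > 0"
  shows "\<exists>(P :: real measure) (v :: real \<Rightarrow> real) (f :: real \<Rightarrow> real).
           prob_space P \<and> v \<in> borel_measurable P \<and> (\<forall>\<omega>\<in>space P. 0 \<le> v \<omega>) \<and>
           A2 P v \<and> A4 P v f \<and> A5 P v f \<and>
           std_dev P v - 1 / sigma_f P v f > K"
proof -
  \<comment> \<open>Chosen so that \<open>\<alpha> / (\<alpha> - 2) = (K + 2)\<^sup>2 + 1\<close>; the summand 2 in \<open>K + 2\<close> absorbs
    \<open>1 / \<sigma>\<^sub>f \<le> 2\<close>.\<close>
  define \<alpha> :: real where "\<alpha> = 2 + 2 / (K + 2)\<^sup>2"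
  let ?P = "density lborel (lomax_density \<alpha> (\<alpha> - 1))"
  let ?v = "max 0 :: real \<Rightarrow> real"
  let ?f = "lomax_density \<alpha> (\<alpha> - 1)"
  have \<alpha>: "2 < \<alpha>" using assms by (simp add: \<alpha>_def)
  interpret P: prob_space ?P
    using \<alpha> by (intro lomax_distributed_max_0(1)) auto
  interpret lomax_variable ?P ?v \<alpha> "\<alpha> - 1"
    using \<alpha> by unfold_locales (auto intro!: lomax_distributed_max_0(2))
  have "A2 ?P ?v"
    using \<alpha> finite_std_dev_v expectation_v by (simp add: A2_def)
  moreover have "std_dev ?P ?v - 1 / sigma_f ?P ?v ?f > K"
  proof -
    have "\<alpha> / (\<alpha> - 2) = (K + 2)\<^sup>2 + 1"
      using assms by (simp add: \<alpha>_def field_simps)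
    then have "K + 2 < std_dev ?P ?v"
      using \<alpha> std_dev_v by (simp add: real_less_rsqrt)
    moreover have "1 / sigma_f ?P ?v ?f \<le> 2"
    proof -
      have "1 / 4 \<le> \<alpha> / (\<alpha> + 2)" using \<alpha> by (simp add: field_simps)
      then have "1 / 2 \<le> sqrt (\<alpha> / (\<alpha> + 2))"
        by (intro real_le_rsqrt) (simp add: power2_eq_square)
      then show ?thesis
        using le_imp_inverse_le[of "1 / 2" "sqrt (\<alpha> / (\<alpha> + 2))"]
        by (simp add: sigma_f_lomax inverse_eq_divide)
    qed
    ultimately show ?thesis by simp
  qed
  ultimately show ?thesis
    using P.prob_space_axioms v_measurable nonneg A4_lomax A5_lomax by blast
qed

end
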